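(* Let $T\in GL(2,\mathbb{R})$ and let $a\in\mathbb{R}^2\setminus\{0\}$ be such that $\|T^{-1}(a)\|<1$. Then the following hold: (1) If an eigenvalue of $T$ is real and positive, then $\overline{T}_a:\mathbb{S}^1\to\mathbb{S}^1$ has a fixed point. (2) Suppose the eigenvalues of $T$ are complex (non-real), of the form $t(\cos\theta\pm i\sin\theta)$ with $t>0$. Then $T=tABA^{-1}$ for some $A\in GL(2,\mathbb{R})$, where $B$ is the rotation of $\mathbb{R}^2$ by the angle $\theta$. For any such $A$, if $\cos\theta>0$ and $|\sin\theta|\le \|T^{-1}(a)\|/(\|A\|\,\|A^{-1}\|)$, then $\overline{T}_a$ has a fixed point.
   Context: $\|\cdot\|$ is the Euclidean norm on $\mathbb{R}^2$, and for matrices the corresponding operator norm; $\mathbb{S}^1$ is the unit circle in $\mathbb{R}^2$. For $T\in GL(2,\mathbb{R})$ and $a\in\mathbb{R}^2\setminus\{0\}$ with $\|T^{-1}(a)\|<1$, the map $\overline{T}_a:\mathbb{S}^1\to\mathbb{S}^1$ is defined by $\overline{T}_a(x)=(a+T(x))/\|a+T(x)\|$; it is well defined because $a+T(x)\neq 0$ for $x\in\mathbb{S}^1$. *)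

theory Defs
  imports "HOL-Analysis.Analysis"
begin

definition matrix_norm :: "real^'n^'m \<Rightarrow> real" where
  "matrix_norm A = onorm ((*v) A)"

definition complex_eigenvalue :: "real^'n^'n \<Rightarrow> complex \<Rightarrow> bool" where
  "complex_eigenvalue A \<mu> \<longleftrightarrow> (\<exists>v. v \<noteq> 0 \<and> map_matrix complex_of_real A *v v = \<mu> *s v)"

definition rotation2 :: "real \<Rightarrow> real^2^2" where
  "rotation2 \<theta> = vector [vector [cos \<theta>, - sin \<theta>], vector [sin \<theta>, cos \<theta>]]"

definition circle_map :: "real^2^2 \<Rightarrow> real^2 \<Rightarrow> real^2 \<Rightarrow> real^2" where
  "circle_map T a x = (a + T *v x) /\<^sub>R norm (a + T *v x)"

text \<open>Under the standing assumptions \<^const>\<open>circle_map\<close> never divides by zero on the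
  unit circle, hence maps it to itself.\<close>

lemma circle_map_nonzero:
  fixes T :: "real^2^2"
  assumes "invertible T" and "norm (matrix_inv T *v a) < 1" and "x \<in> sphere 0 1"
  shows "a + T *v x \<noteq> 0"
proof
  assume "a + T *v x = 0"
  then have "a = - (T *v x)"
    by (simp add: eq_neg_iff_add_eq_0)
  also have "\<dots> = T *v (- x)"
    by (simp add: linear_neg[OF matrix_vector_mul_linear])
  finally have a: "a = T *v (- x)" .
  have "matrix_inv T ** T = mat 1"
    using someI_ex[OF assms(1)[unfolded invertible_def]] by (simp add: matrix_inv_def)
  then have "matrix_inv T *v a = - x"
    by (simp only: a matrix_vector_mul_assoc matrix_vector_mul_lid)
  with assms(2,3) show False by simp
qed

lemma circle_map_in_sphere:
  fixes T :: "real^2^2"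
  assumes "invertible T" and "norm (matrix_inv T *v a) < 1"
  shows "circle_map T a \<in> sphere 0 1 \<rightarrow> sphere 0 1"
  using circle_map_nonzero[OF assms] by (auto simp: circle_map_def)

end

theory Submission
  imports Defs
begin

text \<open>A fixed point of the circle map is a unit vector \<open>x\<close> with \<open>a + T x = r x\<close> for some
  \<open>r > 0\<close>. Suppose there is none. The set of \<open>r \<ge> 0\<close> for which this equation has a solution in
  the open unit ball contains \<open>0\<close>, with solution \<open>x = - T\<^sup>-\<^sup>1 a\<close>, and is closed in \<open>{0..}\<close>. If \<open>r\<close> is an
  eigenvalue, a solution in the ball can be moved along an eigenvector until it has norm 1; so
  \<open>r - T\<close> is invertible for every \<open>r\<close> in the set, which makes the set open. Hence it is all of
  \<open>{0..}\<close> and contains no eigenvalue, which gives the first part. In the second part, the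
  solution for \<open>r = t cos \<theta>\<close> has norm at least 1, because \<open>cos \<theta> - B\<close> is \<open>sin \<theta>\<close> times an
  isometry.\<close>

section \<open>Continuing a solution in the ball along the scalars \<open>r\<close>\<close>

text \<open>Adding multiples of \<open>v\<close> keeps the equation valid. The norm along this line
  starts below 1 and reaches 1 by the intermediate value theorem.\<close>

lemma unit_solution_on_eigenline:
  fixes f :: "'a::real_normed_vector \<Rightarrow> 'a"
  assumes f: "linear f" and x: "norm x < 1" "a + f x = r *\<^sub>R x"
    and v: "f v = r *\<^sub>R v" "v \<noteq> 0"
  obtains y where "norm y = 1" and "a + f y = r *\<^sub>R y"
proof -
  \<comment> \<open>The added vector has norm 2 and \<open>x\<close> has norm below 1, so the sum
    has norm above 1.\<close>
  have "1 \<le> norm (x + (2 / norm v) *\<^sub>R v)"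
    using norm_triangle_ineq4[of "x + (2 / norm v) *\<^sub>R v" x] assms by simp
  moreover have "continuous_on {0..2 / norm v} (\<lambda>s. norm (x + s *\<^sub>R v))"
    by (intro continuous_intros)
  ultimately obtain s where "norm (x + s *\<^sub>R v) = 1"
    using IVT'[of "\<lambda>s. norm (x + s *\<^sub>R v)" 0 1 "2 / norm v"] assms by force
  moreover have "a + f (x + s *\<^sub>R v) = r *\<^sub>R (x + s *\<^sub>R v)"
    by (simp add: linear_add[OF f] linear_scale[OF f] v(1) x(2) scaleR_add_right
        flip: add.assoc)
  ultimately show thesis
    by (rule that)
qed

text \<open>The hypothesis \<open>no_unit\<close> acts twice: it keeps limits of ball solutions off
  the sphere, which makes \<open>K\<close> closed, and it keeps eigenvalues out of \<open>K\<close>,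
  which makes \<open>K\<close> open in the half-line.\<close>

lemma ball_solution_all_scalars:
  fixes f :: "'a::euclidean_space \<Rightarrow> 'a"
  assumes f: "linear f"
    and start: "norm x\<^sub>0 < 1" "a + f x\<^sub>0 = 0"
    and no_unit: "\<And>r x. 0 \<le> r \<Longrightarrow> norm x = 1 \<Longrightarrow> a + f x \<noteq> r *\<^sub>R x"
    and "0 \<le> r"
  shows "\<exists>x. norm x < 1 \<and> a + f x = r *\<^sub>R x"
proof -
  define K where "K = {r. 0 \<le> r \<and> (\<exists>x. norm x < 1 \<and> a + f x = r *\<^sub>R x)}"
  have contf: "continuous_on S f" for S
    using f linear_continuous_on linear_conv_bounded_linear by blast
  have "closed K"
    unfolding closed_sequential_limits
  proof (intro allI impI, elim conjE)
    fix R l assume R: "\<forall>n. R n \<in> K" and l: "R \<longlonglongrightarrow> l"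
    then have "\<forall>n. \<exists>x. norm x < 1 \<and> a + f x = R n *\<^sub>R x"
      by (auto simp: K_def)
    then obtain X where X: "\<And>n. norm (X n) < 1" "\<And>n. a + f (X n) = R n *\<^sub>R X n"
      by metis
    have "\<forall>n. X n \<in> cball 0 1"
      using X(1) by (simp add: less_imp_le)
    then obtain x h where h: "strict_mono h" and x: "x \<in> cball 0 1" "(X \<circ> h) \<longlonglongrightarrow> x"
      using compact_cball[of "0::'a" 1] unfolding compact_def by blast
    have "(\<lambda>n. a + f (X (h n))) \<longlonglongrightarrow> a + f x"
      using x(2) contf[of UNIV] by (auto intro!: tendsto_intros
          simp: continuous_on_sequentially comp_def)
    moreover have "(\<lambda>n. a + f (X (h n))) \<longlonglongrightarrow> l *\<^sub>R x"
      unfolding X(2)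
      using x(2) LIMSEQ_subseq_LIMSEQ[OF l h] by (auto intro!: tendsto_intros simp: comp_def)
    ultimately have eq: "a + f x = l *\<^sub>R x"
      by (rule LIMSEQ_unique)
    have "0 \<le> l"
      using R l by (auto intro!: LIMSEQ_le_const simp: K_def)
    with eq no_unit x(1) have "norm x < 1"
      by (metis less_eq_real_def mem_cball_0)
    with eq \<open>0 \<le> l\<close> show "l \<in> K"
      by (auto simp: K_def)
  qed
  then have "closedin (top_of_set {0..}) K"
    by (intro closed_subset) (auto simp: K_def)
  moreover have "openin (top_of_set {0..}) K"
    unfolding openin_euclidean_subtopology_iff
  proof (intro conjI ballI)
    fix r assume "r \<in> K"
    then obtain x where x: "0 \<le> r" "norm x < 1" "a + f x = r *\<^sub>R x"
      by (auto simp: K_def)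
    define g where "g r y = r *\<^sub>R y - f y" for r y
    have g: "linear (g r)" for r
      by (rule linearI) (simp_all add: g_def linear_add[OF f] linear_scale[OF f] algebra_simps)
    have "inj (g r)"
      unfolding linear_injective_0[OF g]
    proof (intro allI impI, rule ccontr)
      fix v assume "g r v = 0" "v \<noteq> 0"
      with f x obtain y where "norm y = 1" "a + f y = r *\<^sub>R y"
        using unit_solution_on_eigenline[of f x a r v] by (auto simp: g_def)
      with no_unit x(1) show False
        by blast
    qed
    then obtain c where c: "c > 0" "\<And>y. c * norm y \<le> norm (g r y)"
      using linear_inj_bounded_below_pos[OF g] by blast
    \<comment> \<open>As \<open>d\<close> is at most \<open>c / 2\<close>, every \<open>g q\<close>
      with \<open>q\<close> within \<open>d\<close> of \<open>r\<close> is still bounded below by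
      \<open>c / 2\<close>. The factor \<open>1 - norm x\<close> bounds how far the solution may
      move without leaving the ball.\<close>
    define d where "d = c * (1 - norm x) / 2"
    have "d > 0"
      using c x by (simp add: d_def)
    moreover have "q \<in> K" if q: "0 \<le> q" "\<bar>q - r\<bar> < d" for q
    proof -
      have "d \<le> c / 2"
        using c x by (simp add: d_def mult_left_le)
      have below: "c / 2 * norm y \<le> norm (g q y)" for y
      proof -
        have "norm (g r y) \<le> norm (g q y) + \<bar>q - r\<bar> * norm y"
          using norm_triangle_ineq4[of "g q y" "(q - r) *\<^sub>R y"]
          norm_scaleR[of "q - r" y] by (simp add: g_def scaleR_diff_left del: norm_scaleR)
        moreover have "\<bar>q - r\<bar> * norm y \<le> c / 2 * norm y"
          using q \<open>d \<le> c / 2\<close> by (intro mult_right_mono) auto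
        ultimately show ?thesis
          using c(2)[of y] by simp
      qed
      have "inj (g q)"
        unfolding linear_injective_0[OF g]
      proof (intro allI impI)
        fix y assume "g q y = 0"
        with below[of y] c(1) show "y = 0"
          by (simp add: mult_le_0_iff)
      qed
      then have "surj (g q)"
        using g linear_injective_imp_surjective by blast
      then obtain y where y: "g q y = a"
        by (metis surjD)
      \<comment> \<open>Both \<open>g q y\<close> and \<open>g r x\<close> equal \<open>a\<close>;
        comparing them isolates the effect of changing the scalar.\<close>
      have "g q (y - x) = (r - q) *\<^sub>R x"
        using y x(3) by (simp add: g_def linear_diff[OF f] algebra_simps)
      with below[of "y - x"] have "c / 2 * norm (y - x) \<le> \<bar>q - r\<bar> * norm x"
        by (simp add: abs_minus_commute)
      also have "\<dots> \<le> \<bar>q - r\<bar> * 1"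
        using x(2) by (intro mult_left_mono) auto
      also have "\<dots> < c / 2 * (1 - norm x)"
        using q(2) by (simp add: d_def)
      finally have "norm (y - x) < 1 - norm x"
        using c(1) by simp
      then have "norm y < 1"
        using norm_triangle_ineq[of x "y - x"] by simp
      moreover have "a + f y = q *\<^sub>R y"
        using y by (simp add: g_def algebra_simps)
      ultimately show ?thesis
        using q(1) by (auto simp: K_def)
    qed
    ultimately show "\<exists>e>0. \<forall>q\<in>{0..}. dist q r < e \<longrightarrow> q \<in> K"
      by (auto simp: dist_real_def)
  qed (auto simp: K_def)
  ultimately have "K = {} \<or> K = {0..}"
    using connected_clopen[of "{0::real..}"] convex_connected by (metis convex_real_interval(1))
  moreover have "0 \<in> K"
    using start by (auto simp: K_def)
  ultimately show ?thesis
    using \<open>0 \<le> r\<close> by (force simp: K_def)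
qed


section \<open>From the scalar equation to the circle map\<close>

lemma matrix_inv_mult:
  fixes A :: "'a::semiring_1^'n^'m"
  assumes "invertible A"
  shows "matrix_inv A ** A = mat 1" and "A ** matrix_inv A = mat 1"
  using someI_ex[OF assms[unfolded invertible_def]] by (simp_all add: matrix_inv_def)

lemma matrix_inv_cancel:
  fixes A :: "real^'n^'n"
  assumes "invertible A"
  shows "matrix_inv A *v (A *v x) = x" and "A *v (matrix_inv A *v x) = x"
  by (simp_all add: matrix_vector_mul_assoc matrix_inv_mult[OF assms])

text \<open>Since \<open>a + T *v x\<close> does not vanish, \<open>r\<close> is positive and equals
  its norm, so normalising returns \<open>x\<close>.\<close>

lemma circle_map_fixed_pointI:
  assumes "0 \<le> r" "norm x = 1" "a + T *v x = r *\<^sub>R x" "a + T *v x \<noteq> 0"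
  shows "circle_map T a x = x"
  using assms by (auto simp: circle_map_def)

text \<open>This is the form in which the continuation is applied: a positive real eigenvalue
  contradicts the last conclusion, and the complex case uses the solution in the ball.\<close>

lemma circle_map_no_fixed_point_imp:
  fixes T :: "real^2^2"
  assumes T: "invertible T" "norm (matrix_inv T *v a) < 1"
    and no_fix: "\<not> (\<exists>x \<in> sphere 0 1. circle_map T a x = x)"
    and "0 \<le> r"
  obtains x where "norm x < 1" and "a + T *v x = r *\<^sub>R x"
    and "\<And>v. T *v v = r *\<^sub>R v \<Longrightarrow> v = 0"
proof -
  have no_unit: False if "0 \<le> q" "norm x = 1" "a + T *v x = q *\<^sub>R x" for q x
  proof -
    have "x \<in> sphere 0 1"
      using that(2) by simp
    with circle_map_fixed_pointI[OF that circle_map_nonzero[OF T]] no_fix show False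
      by blast
  qed
  \<comment> \<open>The starting solution at scalar 0; it lies in the open ball by the bound on
    \<open>matrix_inv T *v a\<close>.\<close>
  have "a + T *v (- (matrix_inv T *v a)) = 0"
    by (simp add: linear_neg[OF matrix_vector_mul_linear] matrix_inv_cancel[OF T(1)])
  then obtain x where x: "norm x < 1" "a + T *v x = r *\<^sub>R x"
    using ball_solution_all_scalars[OF matrix_vector_mul_linear[of T],
        of "- (matrix_inv T *v a)" a r] T(2) no_unit \<open>0 \<le> r\<close> by auto
  moreover have "v = 0" if "T *v v = r *\<^sub>R v" for v
    using unit_solution_on_eigenline[OF matrix_vector_mul_linear[of T] x that] no_unit \<open>0 \<le> r\<close>
    by blast
  ultimately show thesis
    using that by blast
qed

section \<open>Eigenvalues and the normal form with a rotation\<close>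

text \<open>With \<open>T\<close> and \<open>r\<close> real, the real and imaginary parts of a
  complex eigenvector satisfy the equation separately, and one of them is nonzero.\<close>

lemma complex_eigenvalue_of_real_imp:
  fixes T :: "real^'n^'n"
  assumes "complex_eigenvalue T (complex_of_real r)"
  obtains v where "v \<noteq> 0" and "T *v v = r *\<^sub>R v"
proof -
  obtain v where v: "v \<noteq> 0" "map_matrix complex_of_real T *v v = complex_of_real r *s v"
    using assms by (auto simp: complex_eigenvalue_def)
  define u where "u = (\<chi> i. Re (v $ i))"
  define w where "w = (\<chi> i. Im (v $ i))"
  have *: "(\<Sum>j\<in>UNIV. complex_of_real (T $ i $ j) * v $ j) = complex_of_real r * v $ i" for i
    using v(2) by (auto simp: vec_eq_iff matrix_vector_mult_def map_matrix_def)
  have "T *v u = r *\<^sub>R u"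
    using arg_cong[OF *, of Re] by (simp add: vec_eq_iff matrix_vector_mult_def u_def)
  moreover have "T *v w = r *\<^sub>R w"
    using arg_cong[OF *, of Im] by (simp add: vec_eq_iff matrix_vector_mult_def w_def)
  moreover have "u \<noteq> 0 \<or> w \<noteq> 0"
    using v(1) by (auto simp: vec_eq_iff u_def w_def complex_eq_iff)
  ultimately show thesis
    using that by blast
qed

lemma complex_eigenvalue_2_imp:
  fixes T :: "real^2^2"
  assumes "complex_eigenvalue T z"
  shows "(complex_of_real (T$1$1) - z) * (complex_of_real (T$2$2) - z)
    = complex_of_real (T$1$2 * T$2$1)"
proof -
  obtain v where v: "v \<noteq> 0" "map_matrix complex_of_real T *v v = z *s v"
    using assms by (auto simp: complex_eigenvalue_def)
  define p q where "p = v $ 1" and "q = v $ 2"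
  have e1: "(complex_of_real (T$1$1) - z) * p + complex_of_real (T$1$2) * q = 0"
    and e2: "complex_of_real (T$2$1) * p + (complex_of_real (T$2$2) - z) * q = 0"
    using v(2) by (auto simp: vec_eq_iff forall_2 matrix_vector_mult_def map_matrix_def sum_2
        p_def q_def algebra_simps)
  \<comment> \<open>The determinant of \<open>T - z\<close>; eliminating between \<open>e1\<close>
    and \<open>e2\<close> shows that it annihilates both coordinates of the eigenvector.\<close>
  let ?d = "(complex_of_real (T$1$1) - z) * (complex_of_real (T$2$2) - z)
    - complex_of_real (T$1$2) * complex_of_real (T$2$1)"
  have "?d * p = 0" "?d * q = 0"
    using e1 e2 by algebra+
  moreover have "p \<noteq> 0 \<or> q \<noteq> 0"
    using v(1) by (auto simp: vec_eq_iff forall_2 p_def q_def)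
  ultimately show ?thesis
    by auto
qed

text \<open>The first basis vector is an eigenvector. A matrix without real eigenvalues therefore
  has \<open>T$2$1\<close> nonzero, as the normal form requires.\<close>

lemma complex_eigenvalue_triangular_2:
  fixes T :: "real^2^2"
  assumes "T$2$1 = 0"
  shows "complex_eigenvalue T (complex_of_real (T$1$1))"
  unfolding complex_eigenvalue_def
  by (rule exI[of _ "vector [1, 0]"])
     (use assms in \<open>simp add: vec_eq_iff forall_2 matrix_vector_mult_def map_matrix_def sum_2\<close>)

lemma similar_to_scaled_rotation2:
  fixes T :: "real^2^2"
  assumes ev: "complex_eigenvalue T
      (complex_of_real t * (complex_of_real (cos \<theta>) + \<i> * complex_of_real (sin \<theta>)))"
    and ts: "t * sin \<theta> \<noteq> 0" and T21: "T$2$1 \<noteq> 0"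
  shows "\<exists>A::real^2^2. invertible A \<and> T = t *\<^sub>R (A ** rotation2 \<theta> ** matrix_inv A)"
proof -
  define c s where "c = t * cos \<theta>" and "s = t * sin \<theta>"
  have "s \<noteq> 0"
    using ts by (simp add: s_def)
  \<comment> \<open>Real and imaginary parts of the characteristic equation at
    \<open>c + i s\<close>; the second fixes the trace as \<open>2 * c\<close>.\<close>
  have *: "(T$1$1 - c) * (T$2$2 - c) - s * s = T$1$2 * T$2$1"
    "s * (T$1$1 - c) + s * (T$2$2 - c) = 0"
    using complex_eigenvalue_2_imp[OF ev]
    by (auto simp: complex_eq_iff c_def s_def algebra_simps)
  have tr: "T$2$2 = 2 * c - T$1$1"
  proof -
    have "s * (T$1$1 - c + (T$2$2 - c)) = 0"
      using *(2) by (simp add: algebra_simps)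
    then show ?thesis
      using \<open>s \<noteq> 0\<close> by simp
  qed
  have det: "T$1$2 * T$2$1 = - (T$1$1 - c)\<^sup>2 - s\<^sup>2"
    using *(1) tr by (simp add: power2_eq_square algebra_simps)
  \<comment> \<open>The first column is \<open>e\<^sub>1\<close>; \<open>T A = t A B\<close> then forces the second to be \<open>(T e\<^sub>1 - c e\<^sub>1) / s\<close>.\<close>
  define A :: "real^2^2" where
    "A = vector [vector [1, (T$1$1 - c) / s], vector [0, T$2$1 / s]]"
  have A: "invertible A"
    using T21 \<open>s \<noteq> 0\<close> by (simp add: invertible_det_nz det_2 A_def)
  \<comment> \<open>The second columns agree because \<open>(T - c)^2\<close> maps the first basis
    vector to \<open>- s^2\<close> times itself, by \<open>tr\<close> and
    \<open>det\<close>.\<close>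
  have "T ** A = t *\<^sub>R (A ** rotation2 \<theta>)"
    using \<open>s \<noteq> 0\<close> ts det tr
    by (simp add: A_def rotation2_def matrix_matrix_mult_def vec_eq_iff forall_2 sum_2)
      (simp add: field_simps power2_eq_square c_def s_def)
  then have "T ** (A ** matrix_inv A) = t *\<^sub>R (A ** rotation2 \<theta> ** matrix_inv A)"
    by (simp add: matrix_mul_assoc scalar_matrix_assoc)
  with A show ?thesis
    using matrix_inv_mult(2)[OF A] by auto
qed

section \<open>Norm estimate for the solution at \<open>t * cos \<theta>\<close>\<close>

lemma norm_rotation2: "norm (rotation2 \<theta> *v x) = norm x"
proof -
  have "(norm (rotation2 \<theta> *v x))\<^sup>2
      = (cos \<theta> * x$1 - sin \<theta> * x$2)\<^sup>2 + (sin \<theta> * x$1 + cos \<theta> * x$2)\<^sup>2"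
    unfolding power2_norm_eq_inner
    by (simp add: rotation2_def inner_vec_def matrix_vector_mult_def sum_2 power2_eq_square)
  also have "\<dots> = ((sin \<theta>)\<^sup>2 + (cos \<theta>)\<^sup>2) * ((x$1)\<^sup>2 + (x$2)\<^sup>2)"
    by (simp add: power2_eq_square algebra_simps del: sin_cos_squared_add3)
  also have "\<dots> = (norm x)\<^sup>2"
    unfolding power2_norm_eq_inner sin_cos_squared_add
    by (simp add: inner_vec_def sum_2 power2_eq_square)
  finally show ?thesis
    by simp
qed

text \<open>The cosine terms cancel, leaving \<open>sin \<theta>\<close> times a quarter
  turn.\<close>

lemma norm_cos_minus_rotation2:
  "norm (cos \<theta> *\<^sub>R x - rotation2 \<theta> *v x) = \<bar>sin \<theta>\<bar> * norm x"
proof -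
  have "(norm (cos \<theta> *\<^sub>R x - rotation2 \<theta> *v x))\<^sup>2 = (\<bar>sin \<theta>\<bar> * norm x)\<^sup>2"
    unfolding power_mult_distrib power2_norm_eq_inner
    by (simp add: rotation2_def inner_vec_def matrix_vector_mult_def sum_2 algebra_simps
        power2_eq_square)
  then show ?thesis
    by simp
qed

lemma norm_matrix_vector_le: "norm (A *v x) \<le> matrix_norm A * norm (x :: real^'n)"
  unfolding matrix_norm_def by (rule onorm[OF matrix_vector_mul_bounded_linear])

lemma matrix_norm_nonneg: "0 \<le> matrix_norm (A :: real^'n^'m)"
  unfolding matrix_norm_def by (rule onorm_pos_le[OF matrix_vector_mul_bounded_linear])

text \<open>In the coordinates given by \<open>A\<close> the equation says that the rotation of
  \<open>p\<close> is \<open>cos \<theta> - B\<close> applied to \<open>y\<close>, so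
  \<open>norm p\<close> is exactly \<open>\<bar>sin \<theta>\<bar> * norm y\<close>. Changing
  coordinates back costs the two matrix norms.\<close>

lemma norm_solution_at_scaled_cos:
  fixes A T :: "real^2^2"
  assumes A: "invertible A" and T: "T = t *\<^sub>R (A ** rotation2 \<theta> ** matrix_inv A)" and "t \<noteq> 0"
    and "invertible T" and x: "a + T *v x = (t * cos \<theta>) *\<^sub>R x"
  shows "norm (matrix_inv T *v a)
    \<le> \<bar>sin \<theta>\<bar> * (matrix_norm A * matrix_norm (matrix_inv A)) * norm x"
proof -
  define b where "b = matrix_inv T *v a"
  define y where "y = matrix_inv A *v x"
  define p where "p = matrix_inv A *v b"
  have conj: "matrix_inv A *v (T *v z) = t *\<^sub>R (rotation2 \<theta> *v (matrix_inv A *v z))" for z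
    unfolding T
    by (simp add: matrix_inv_cancel[OF A] scaleR_matrix_vector_assoc[symmetric]
        matrix_vector_mult_scaleR matrix_vector_mul_assoc[symmetric])
  have "T *v b + T *v x = (t * cos \<theta>) *\<^sub>R x"
    using x by (simp add: b_def matrix_inv_cancel[OF \<open>invertible T\<close>])
  then have "matrix_inv A *v (T *v b) + matrix_inv A *v (T *v x)
      = matrix_inv A *v ((t * cos \<theta>) *\<^sub>R x)"
    by (simp only: flip: matrix_vector_right_distrib)
  then have "t *\<^sub>R (rotation2 \<theta> *v p + rotation2 \<theta> *v y) = t *\<^sub>R (cos \<theta> *\<^sub>R y)"
    by (simp add: conj p_def y_def matrix_vector_mult_scaleR scaleR_add_right)
  then have "rotation2 \<theta> *v p = cos \<theta> *\<^sub>R y - rotation2 \<theta> *v y"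
    using \<open>t \<noteq> 0\<close> unfolding scaleR_cancel_left by (simp add: eq_diff_eq)
  then have "norm p = \<bar>sin \<theta>\<bar> * norm y"
    by (metis norm_rotation2 norm_cos_minus_rotation2)
  have "norm b \<le> matrix_norm A * norm p"
    using norm_matrix_vector_le[of A p] by (simp add: p_def matrix_inv_cancel[OF A])
  also have "\<dots> \<le> matrix_norm A * (\<bar>sin \<theta>\<bar> * (matrix_norm (matrix_inv A) * norm x))"
    unfolding \<open>norm p = _\<close> y_def
    by (intro mult_left_mono norm_matrix_vector_le matrix_norm_nonneg) auto
  finally show ?thesis
    by (simp add: b_def mult_ac)
qed

theorem theorem7:
  fixes T :: "real^2^2" and a :: "real^2"
  assumes "invertible T" and "a \<noteq> 0" and "norm (matrix_inv T *v a) < 1"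
  shows
    "((\<exists>\<mu>::real. \<mu> > 0 \<and> complex_eigenvalue T (complex_of_real \<mu>)) \<longrightarrow>
        (\<exists>x \<in> sphere 0 1. circle_map T a x = x)) \<and>
     (\<forall>t \<theta>::real.
        t > 0 \<and>
        {z. complex_eigenvalue T z} =
          {complex_of_real t * (complex_of_real (cos \<theta>) + \<i> * complex_of_real (sin \<theta>)),
           complex_of_real t * (complex_of_real (cos \<theta>) - \<i> * complex_of_real (sin \<theta>))} \<and>
        {z. complex_eigenvalue T z} \<inter> \<real> = {} \<longrightarrow>
        (\<exists>A::real^2^2. invertible A \<and> T = t *\<^sub>R (A ** rotation2 \<theta> ** matrix_inv A)) \<and>
        (\<forall>A::real^2^2.
           invertible A \<and> T = t *\<^sub>R (A ** rotation2 \<theta> ** matrix_inv A) \<and>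
           cos \<theta> > 0 \<and>
           \<bar>sin \<theta>\<bar> \<le> norm (matrix_inv T *v a) / (matrix_norm A * matrix_norm (matrix_inv A)) \<longrightarrow>
           (\<exists>x \<in> sphere 0 1. circle_map T a x = x)))"
proof (intro conjI impI allI; (elim conjE exE)?)
  fix \<mu> :: real
  assume "\<mu> > 0" and "complex_eigenvalue T (complex_of_real \<mu>)"
  then obtain v where "v \<noteq> 0" "T *v v = \<mu> *\<^sub>R v"
    using complex_eigenvalue_of_real_imp by blast
  then show "\<exists>x \<in> sphere 0 1. circle_map T a x = x"
    using circle_map_no_fixed_point_imp[OF assms(1,3), of \<mu>] \<open>\<mu> > 0\<close>
    by (metis less_imp_le)
next
  fix t \<theta> :: real
  let ?z = "complex_of_real t * (complex_of_real (cos \<theta>) + \<i> * complex_of_real (sin \<theta>))"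
  assume "t > 0"
    and spec: "{z. complex_eigenvalue T z} = {?z,
      complex_of_real t * (complex_of_real (cos \<theta>) - \<i> * complex_of_real (sin \<theta>))}"
    and nonreal: "{z. complex_eigenvalue T z} \<inter> \<real> = {}"
  have ev: "complex_eigenvalue T ?z"
    using spec by blast
  have sin: "sin \<theta> \<noteq> 0"
  proof
    assume "sin \<theta> = 0"
    then have "?z \<in> \<real>"
      by simp
    with ev nonreal show False
      by blast
  qed
  have "T$2$1 \<noteq> 0"
    using complex_eigenvalue_triangular_2[of T] nonreal by auto
  with ev sin \<open>t > 0\<close>
  show "\<exists>A::real^2^2. invertible A \<and> T = t *\<^sub>R (A ** rotation2 \<theta> ** matrix_inv A)"
    by (intro similar_to_scaled_rotation2) auto
  fix A :: "real^2^2"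
  let ?\<kappa> = "matrix_norm A * matrix_norm (matrix_inv A)"
  assume A: "invertible A" "T = t *\<^sub>R (A ** rotation2 \<theta> ** matrix_inv A)"
    and cos: "cos \<theta> > 0" and le: "\<bar>sin \<theta>\<bar> \<le> norm (matrix_inv T *v a) / ?\<kappa>"
  show "\<exists>x \<in> sphere 0 1. circle_map T a x = x"
  proof (rule ccontr)
    assume "\<not> ?thesis"
    moreover have "0 \<le> t * cos \<theta>"
      using \<open>t > 0\<close> cos by simp
    ultimately obtain x where x: "norm x < 1" "a + T *v x = (t * cos \<theta>) *\<^sub>R x"
      using circle_map_no_fixed_point_imp[OF assms(1,3)] by metis
    \<comment> \<open>Division by 0 yields 0, so a vanishing product would make the bound force
      \<open>sin \<theta> = 0\<close>.\<close>
    have "?\<kappa> \<noteq> 0"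
      using le sin by (intro notI) simp
    then have "?\<kappa> > 0"
      by (simp add: less_le matrix_norm_nonneg)
    have "norm (matrix_inv T *v a) \<le> \<bar>sin \<theta>\<bar> * ?\<kappa> * norm x"
      using norm_solution_at_scaled_cos[OF A _ assms(1) x(2)] \<open>t > 0\<close> by simp
    \<comment> \<open>The inequality is strict because the solution lies in the open ball and
      \<open>sin \<theta>\<close> is nonzero; this contradicts the assumed bound even in its
      equality case.\<close>
    also have "\<dots> < \<bar>sin \<theta>\<bar> * ?\<kappa> * 1"
      using x(1) \<open>?\<kappa> > 0\<close> sin by (intro mult_strict_left_mono) auto
    finally show False
      using le \<open>?\<kappa> > 0\<close> by (simp add: pos_le_divide_eq)
  qed
qed
end
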